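(* Let $P(r)$ and $A(r)$ denote the combinatorial perimeter and the combinatorial area, respectively, of the combinatorial disk $D(r)$ of radius $r$ in the complex $X_7$ (centered at any vertex $v$ of $X_7$). Then for any radius $r$ (a nonnegative integer), $$P(r) \ge \tfrac{1}{7}A(r).$$
   Context: $X_7$ is the simply connected triangulated surface (without boundary) obtained by gluing together equilateral triangles with side length $1$ along their edges so that there are exactly $7$ triangles at every vertex. Combinatorially, it is the tiling of the hyperbolic plane by equilateral triangles with all angles $2\pi/7$, seven around each vertex. Fix any vertex $v$ of $X_7$. The combinatorial disk $D(r)$ of radius $r$ is the subcomplex defined iteratively by: $D(0)=\{v\}$, and $D(r+1)$ is the union of $D(r)$ and all (closed) triangles of $X_7$ that share a vertex with $D(r)$. The combinatorial perimeter $P(r)$ is the number of edges in the boundary $\partial D(r)$, i.e. the number of edges of $X_7$ that lie in exactly one triangle of $D(r)$. The combinatorial area $A(r)$ is the number of triangles of $X_7$ contained in $D(r)$. (In particular $P(0)=A(0)=0$.) *)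

theory Defs
  imports "HOL-Analysis.Analysis"
begin

(* The library's simplicial_complex covers only finite complexes of convex polytopes in a
   Euclidean space, so infinite complexes are given here by the vertex sets of their simplices. *)
definition abstract_simplicial_complex :: "'a set set \<Rightarrow> bool" where
  "abstract_simplicial_complex K \<longleftrightarrow>
     (\<forall>s\<in>K. finite s \<and> s \<noteq> {}) \<and> (\<forall>s\<in>K. \<forall>s'. s' \<subseteq> s \<and> s' \<noteq> {} \<longrightarrow> s' \<in> K)"

definition vertices :: "'a set set \<Rightarrow> 'a set" where
  "vertices K = \<Union>K"

definition edges :: "'a set set \<Rightarrow> 'a set set" where
  "edges K = {e \<in> K. card e = 2}"

definition triangles :: "'a set set \<Rightarrow> 'a set set" where
  "triangles K = {t \<in> K. card t = 3}"

(* Points are given by their barycentric coordinates, so every triangle is realized as an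
   equilateral one.  Subsets of 'a => real carry the product topology; on the realization of a
   locally finite complex (the only case used) it agrees with the usual weak topology. *)
definition geometric_realization :: "'a set set \<Rightarrow> ('a \<Rightarrow> real) set" where
  "geometric_realization K =
     {x. (\<forall>a. 0 \<le> x a) \<and> {a. x a \<noteq> 0} \<in> K \<and> (\<Sum>a | x a \<noteq> 0. x a) = 1}"

(* Surface without boundary: the triangles at u are {u, w 0, w 1}, ..., {u, w (n - 1), w 0},
   i.e. the link of every vertex is a cycle.  In particular every edge is in two triangles. *)
definition triangulated_surface :: "'a set set \<Rightarrow> bool" where
  "triangulated_surface K \<longleftrightarrow>
     abstract_simplicial_complex K \<and>
     (\<forall>s\<in>K. \<exists>t\<in>triangles K. s \<subseteq> t) \<and>
     (\<forall>u\<in>vertices K. \<exists>(n::nat)\<ge>3. \<exists>w. inj_on w {..<n} \<and>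
        {t \<in> triangles K. u \<in> t} = (\<lambda>i. {u, w i, w (Suc i mod n)}) ` {..<n})"

(* These conditions determine a nonempty K up to isomorphism. *)
definition is_X7 :: "'a set set \<Rightarrow> bool" where
  "is_X7 K \<longleftrightarrow>
     triangulated_surface K \<and>
     simply_connected (geometric_realization K) \<and>
     (\<forall>u\<in>vertices K. card {t \<in> triangles K. u \<in> t} = 7)"

primrec comb_disk :: "'a set set \<Rightarrow> 'a \<Rightarrow> nat \<Rightarrow> 'a set set" where
  "comb_disk K v 0 = {{v}}"
| "comb_disk K v (Suc r) =
     comb_disk K v r \<union>
     {s \<in> K. \<exists>t\<in>triangles K. s \<subseteq> t \<and> t \<inter> vertices (comb_disk K v r) \<noteq> {}}"

definition comb_perimeter :: "'a set set \<Rightarrow> 'a \<Rightarrow> nat \<Rightarrow> nat" where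
  "comb_perimeter K v r =
     card {e \<in> edges K. card {t \<in> triangles (comb_disk K v r). e \<subseteq> t} = 1}"

definition comb_area :: "'a set set \<Rightarrow> 'a \<Rightarrow> nat \<Rightarrow> nat" where
  "comb_area K v r = card (triangles (comb_disk K v r))"

end

theory Submission
  imports Defs
begin

text \<open>
  Develop \<open>X\<^sub>7\<close> into the hyperbolic plane, with a horofunction \<open>F\<close> (the exponential of a Busemann
  function, i.e. the Minkowski product with a lightlike vector). With \<open>\<lambda> = 2 cos (2 \<pi> / 7)\<close>, written \<open>l\<close> below, the values
  of \<open>F\<close> satisfy \<open>F z + F z' = \<lambda> (F u + F w)\<close> for any two triangles \<open>uwz\<close>, \<open>uwz'\<close> with a common edge, and
  \<open>p\<^sup>2 + q\<^sup>2 + r\<^sup>2 = \<lambda> (pq + qr + rp)\<close> on every triangle. These relations alone suffice: locally they can be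
  solved around a vertex because the resulting linear recurrence has period 7, and the local solutions
  fit together because the realization is simply connected. The flux \<open>\<lambda>/2 - F z / (F u + F w)\<close> out of
  the triangle \<open>uwz\<close> through its edge \<open>uw\<close> is the negative of the flux out of the neighbouring triangle,
  it is at most \<open>1/2\<close>, and the three fluxes out of a triangle add up to at least \<open>1/14\<close>. Summing over any
  finite set of triangles gives \<open>A / 14 \<le> P / 2\<close>.
\<close>

subsection \<open>Monodromy of local systems\<close>

lemma simplex_face:
  "\<lbrakk>abstract_simplicial_complex K; s \<in> K; s' \<subseteq> s; s' \<noteq> {}\<rbrakk> \<Longrightarrow> s' \<in> K"
  unfolding abstract_simplicial_complex_def by blast

text \<open>Supports are written with \<open>> 0\<close> because positivity of one coordinate, the
  open star of a vertex, is an open condition.\<close>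

lemma realization_support:
  assumes "x \<in> geometric_realization K"
  shows "{a. x a > 0} \<in> K" "{a. x a > 0} \<noteq> {}"
proof -
  have *: "{a. x a > 0} = {a. x a \<noteq> 0}"
    using assms unfolding geometric_realization_def by (auto simp: less_le)
  show "{a. x a > 0} \<in> K"
    using assms unfolding * geometric_realization_def by blast
  show "{a. x a > 0} \<noteq> {}"
    using assms unfolding * geometric_realization_def by force
qed

section \<open>Edge loops as paths in the geometric realization\<close>

text \<open>Vertex \<open>u i\<close> carries a hat function centred at time \<open>i / n\<close>.
  Summing over indices rather than vertices lets \<open>u\<close> repeat vertices.\<close>

definition edge_path :: "(nat \<Rightarrow> 'a) \<Rightarrow> nat \<Rightarrow> real \<Rightarrow> 'a \<Rightarrow> real" where
  "edge_path u n t a = (\<Sum>i\<le>n. if u i = a then max 0 (1 - \<bar>real n * t - real i\<bar>) else 0)"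

text \<open>On this time interval only the hats of the indices \<open>k\<close> and
  \<open>Suc k\<close> are nonzero.\<close>

lemma edge_path_segment:
  assumes "k < n" "real k \<le> real n * t" "real n * t \<le> real (Suc k)"
  shows "edge_path u n t a =
    (if u k = a then 1 - (real n * t - real k) else 0) + (if u (Suc k) = a then real n * t - real k else 0)"
proof -
  have "edge_path u n t a = (\<Sum>i\<in>{k, Suc k}. if u i = a then max 0 (1 - \<bar>real n * t - real i\<bar>) else 0)"
    unfolding edge_path_def
  proof (rule sum.mono_neutral_right)
    show "\<forall>i\<in>{..n} - {k, Suc k}. (if u i = a then max 0 (1 - \<bar>real n * t - real i\<bar>) else 0) = 0"
    proof
      fix i assume "i \<in> {..n} - {k, Suc k}"
      then have "i < k \<or> i > Suc k" by auto
      then have "real i + 1 \<le> real k \<or> real i \<ge> real (Suc k) + 1" by linarith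
      then show "(if u i = a then max 0 (1 - \<bar>real n * t - real i\<bar>) else 0) = 0"
        using assms by auto
    qed
  qed (use assms in auto)
  then show ?thesis using assms by (simp add: algebra_simps)
qed

lemma edge_path_vertex:
  assumes "k \<le> n" "n > 0"
  shows "edge_path u n (real k / real n) a = (if u k = a then 1 else 0)"
proof (cases "k = n")
  case True
  then obtain m where "n = Suc m" using assms by (cases n) auto
  then show ?thesis using edge_path_segment[of m n 1 u a] True by auto
next
  case False
  then show ?thesis using edge_path_segment[of k n "real k / real n" u a] assms by simp
qed

lemma obtain_unit_segment:
  assumes "0 \<le> t" "t \<le> 1" "(n::nat) > 0"
  obtains k where "k < n" "real k \<le> real n * t" "real n * t \<le> real (Suc k)"
proof (cases "t = 1")
  case True
  then show ?thesis using that[of "n - 1"] assms by (simp add: of_nat_diff)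
next
  case False
  have "real n * t < real n" using False assms by simp
  moreover have "real (nat \<lfloor>real n * t\<rfloor>) \<le> real n * t" "real n * t \<le> real (Suc (nat \<lfloor>real n * t\<rfloor>))"
    using assms by (auto simp: of_nat_nat) linarith+
  ultimately show ?thesis using that[of "nat \<lfloor>real n * t\<rfloor>"] by linarith
qed

lemma edge_path_in_realization:
  assumes K: "abstract_simplicial_complex K" and "n > 0" "0 \<le> t" "t \<le> 1"
    and E: "\<And>i. i < n \<Longrightarrow> {u i, u (Suc i)} \<in> K"
  shows "edge_path u n t \<in> geometric_realization K"
proof -
  obtain k where k: "k < n" "real k \<le> real n * t" "real n * t \<le> real (Suc k)"
    using obtain_unit_segment assms by metis
  define \<theta> where "\<theta> = real n * t - real k"
  have \<theta>: "0 \<le> \<theta>" "\<theta> \<le> 1" using k by (auto simp: \<theta>_def)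
  have eq: "edge_path u n t = (\<lambda>a. (if u k = a then 1 - \<theta> else 0) + (if u (Suc k) = a then \<theta> else 0))"
    unfolding \<theta>_def by (rule ext) (rule edge_path_segment[OF k])
  have sub: "{a. edge_path u n t a \<noteq> 0} \<subseteq> {u k, u (Suc k)}"
    by (auto simp: eq split: if_splits)
  have tot: "(\<Sum>a | edge_path u n t a \<noteq> 0. edge_path u n t a) = 1"
  proof -
    have "(\<Sum>a | edge_path u n t a \<noteq> 0. edge_path u n t a) = (\<Sum>a\<in>{u k, u (Suc k)}. edge_path u n t a)"
      by (rule sum.mono_neutral_left) (use sub in auto)
    also have "\<dots> = 1" by (cases "u k = u (Suc k)") (auto simp: eq)
    finally show ?thesis .
  qed
  then have "{a. edge_path u n t a \<noteq> 0} \<noteq> {}" by force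
  then have "{a. edge_path u n t a \<noteq> 0} \<in> K"
    using K E[OF k(1)] sub unfolding abstract_simplicial_complex_def by blast
  moreover have "\<forall>a. 0 \<le> edge_path u n t a" using \<theta> by (auto simp: eq)
  ultimately show ?thesis using tot unfolding geometric_realization_def by blast
qed

lemma path_edge_path: "path (edge_path u n)"
proof -
  have "continuous_on {0..1} (\<lambda>t. edge_path u n t a)" for a
    unfolding edge_path_def
  proof (rule continuous_on_sum)
    fix i
    show "continuous_on {0..1} (\<lambda>t. if u i = a then max 0 (1 - \<bar>real n * t - real i\<bar>) else 0)"
      by (cases "u i = a") (auto intro!: continuous_intros)
  qed
  then show ?thesis unfolding path_def by (rule continuous_on_coordinatewise_then_product)
qed

section \<open>Subdivision of a homotopy into small squares\<close>

text \<open>Preimages of open vertex stars cover the compact square, so by a Lebesgue number each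
  closed cell of a fine grid maps into one star. \<open>n dvd N\<close> puts the times
  \<open>i / n\<close> of an edge loop on the grid.\<close>

lemma square_star_grid:
  fixes h :: "real \<times> real \<Rightarrow> 'a \<Rightarrow> real"
  assumes cont: "continuous_on ({0..1} \<times> {0..1}) h"
    and im: "h \<in> {0..1} \<times> {0..1} \<rightarrow> geometric_realization K" and "n > 0"
  obtains N c where "N > 0" "n dvd N"
    "\<And>i j s t. \<lbrakk>i < N; j < N; real i \<le> real N * s; real N * s \<le> real (Suc i);
       real j \<le> real N * t; real N * t \<le> real (Suc j)\<rbrakk> \<Longrightarrow> h (s, t) (c i j) > 0"
proof -
  let ?Q = "{0..1::real} \<times> {0..1::real}"
  define \<G> where "\<G> = {A. open A \<and> (\<exists>a. \<forall>q\<in>A \<inter> ?Q. h q a > 0)}"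
  have cov: "?Q \<subseteq> \<Union>\<G>"
  proof
    fix q assume q: "q \<in> ?Q"
    obtain a where a: "h q a > 0"
      using im q realization_support(2)[of "h q" K] by auto
    have "continuous_on ?Q (\<lambda>q. h q a)"
      by (rule continuous_on_product_then_coordinatewise[OF cont])
    then obtain A where "open A" "A \<inter> ?Q = (\<lambda>q. h q a) -` {0<..} \<inter> ?Q"
      using continuous_on_open_invariant open_greaterThan by metis
    then show "q \<in> \<Union>\<G>" using q a unfolding \<G>_def by blast
  qed
  have "compact ?Q" by (simp add: compact_Times)
  then obtain e where e: "e > 0" "\<And>x. x \<in> ?Q \<Longrightarrow> \<exists>G \<in> \<G>. ball x e \<subseteq> G"
    using Heine_Borel_lemma[OF _ cov] unfolding \<G>_def by blast
  \<comment> \<open>A closed cell of side \<open>1 / N\<close> lies within \<open>2 / N\<close> of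
    its lower left corner; this has to be below the Lebesgue number \<open>e\<close>.\<close>
  obtain M :: nat where M: "real M > 2 / e" using reals_Archimedean2 by blast
  define N where "N = n * Suc M"
  have N: "N > 0" "n dvd N" using \<open>n > 0\<close> by (auto simp: N_def)
  have "real M \<le> real N" using \<open>n > 0\<close> unfolding N_def
    by (metis One_nat_def Suc_leI le_SucI le_trans mult_le_mono1 nat_mult_1 of_nat_le_iff order_refl)
  then have "2 / e < real N" using M by linarith
  then have Ne: "2 / real N < e" using e(1) N by (simp add: field_simps)
  have "\<exists>a. \<forall>s t. real i \<le> real N * s \<and> real N * s \<le> real (Suc i) \<and>
       real j \<le> real N * t \<and> real N * t \<le> real (Suc j) \<longrightarrow> h (s, t) a > 0" if "i < N" "j < N" for i j
  proof -
    let ?p = "(real i / real N, real j / real N)"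
    have "?p \<in> ?Q" using that by auto
    then obtain G where G: "G \<in> \<G>" "ball ?p e \<subseteq> G" using e(2) by blast
    then obtain a where a: "\<forall>q\<in>G \<inter> ?Q. h q a > 0" unfolding \<G>_def by blast
    have "h (s, t) a > 0" if st: "real i \<le> real N * s" "real N * s \<le> real (Suc i)"
       "real j \<le> real N * t" "real N * t \<le> real (Suc j)" for s t
    proof -
      have s: "real i / real N \<le> s" "s \<le> real (Suc i) / real N"
        and t: "real j / real N \<le> t" "t \<le> real (Suc j) / real N"
        using st N by (auto simp: field_simps)
      have "real (Suc i) / real N \<le> 1" "real (Suc j) / real N \<le> 1"
        using \<open>i < N\<close> \<open>j < N\<close> by auto
      then have Q: "(s, t) \<in> ?Q" using s t
        by (smt (verit) SigmaI atLeastAtMost_iff divide_nonneg_nonneg of_nat_0_le_iff)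
      have "dist ?p (s, t) \<le> dist (real i / real N) s + dist (real j / real N) t"
        using dist_triangle[of ?p "(s, t)" "(s, real j / real N)"]
        by (simp add: dist_Pair_Pair)
      also have "\<dots> \<le> 1 / real N + 1 / real N"
        using s t by (auto simp: dist_real_def add_divide_distrib)
      also have "\<dots> < e" using Ne by simp
      finally show ?thesis using a G(2) Q by auto
    qed
    then show ?thesis by blast
  qed
  then obtain c where "\<And>i j s t. \<lbrakk>i < N; j < N; real i \<le> real N * s; real N * s \<le> real (Suc i);
       real j \<le> real N * t; real N * t \<le> real (Suc j)\<rbrakk> \<Longrightarrow> h (s, t) (c i j) > 0"
    by metis
  with N that show thesis by blast
qed

section \<open>Transport along vertex sequences\<close>

primrec transport :: "('a \<Rightarrow> 'a \<Rightarrow> 's \<Rightarrow> 's) \<Rightarrow> (nat \<Rightarrow> 'a) \<Rightarrow> nat \<Rightarrow> 's \<Rightarrow> 's" where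
  "transport T c 0 x = x"
| "transport T c (Suc n) x = T (c n) (c (Suc n)) (transport T c n x)"

lemma transport_add:
  "transport T c (m + k) x = transport T (\<lambda>i. c (m + i)) k (transport T c m x)"
  by (induction k) auto

text \<open>A locally constant sheaf, given by stalks at vertices and transition maps along edges.
  Vertices may coincide in the cocycle condition \<open>T_comp\<close>, which therefore also yields
  inverses.\<close>

locale local_system =
  fixes K :: "'a set set" and S :: "'a \<Rightarrow> 's set" and T :: "'a \<Rightarrow> 'a \<Rightarrow> 's \<Rightarrow> 's"
  assumes complex: "abstract_simplicial_complex K"
    and T_in: "\<And>u w x. \<lbrakk>{u, w} \<in> K; x \<in> S u\<rbrakk> \<Longrightarrow> T u w x \<in> S w"
    and T_comp: "\<And>u w z x. \<lbrakk>{u, w, z} \<in> K; x \<in> S u\<rbrakk> \<Longrightarrow> T w z (T u w x) = T u z x"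
    and T_refl: "\<And>u x. \<lbrakk>u \<in> vertices K; x \<in> S u\<rbrakk> \<Longrightarrow> T u u x = x"
begin

lemma subsimplex: "\<lbrakk>\<sigma> \<in> K; \<tau> \<subseteq> \<sigma>; \<tau> \<noteq> {}\<rbrakk> \<Longrightarrow> \<tau> \<in> K"
  by (rule simplex_face[OF complex])

lemma T_inverse:
  assumes "{u, w} \<in> K" "x \<in> S u"
  shows "T w u (T u w x) = x"
proof -
  have "{u, w, u} \<in> K" using assms by (simp add: insert_commute)
  then have "T w u (T u w x) = T u u x" using assms T_comp by blast
  also have "\<dots> = x" using assms by (intro T_refl) (auto simp: vertices_def)
  finally show ?thesis .
qed

lemma transport_in:
  assumes "\<And>i. i < n \<Longrightarrow> {c i, c (Suc i)} \<in> K" "x \<in> S (c 0)"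
  shows "transport T c n x \<in> S (c n)"
  using assms by (induction n) (auto intro: T_in)

lemma transport_in_simplex:
  assumes "\<sigma> \<in> K" "\<And>i. i \<le> n \<Longrightarrow> c i \<in> \<sigma>" "x \<in> S (c 0)"
  shows "transport T c n x = T (c 0) (c n) x"
  using assms
proof (induction n)
  case 0
  then show ?case by (auto simp: vertices_def intro!: T_refl[symmetric])
next
  case (Suc n)
  have "{c 0, c n, c (Suc n)} \<in> K"
    by (rule subsimplex[OF Suc.prems(1)]) (use Suc.prems(2) in auto)
  then show ?case using Suc by (simp add: T_comp)
qed

text \<open>Both ways from \<open>c j\<close> to \<open>d (Suc j)\<close> agree because the square
  lies in one simplex; these commuting squares compose along the ladder.\<close>

lemma transport_ladder:
  assumes "\<And>j. j < n \<Longrightarrow> \<exists>\<sigma>\<in>K. {c j, d j, c (Suc j), d (Suc j)} \<subseteq> \<sigma>"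
    and "x \<in> S (c 0)" "n > 0"
  shows "T (c n) (d n) (transport T c n x) = transport T d n (T (c 0) (d 0) x)"
proof -
  have "T (c m) (d m) (transport T c m x) = transport T d m (T (c 0) (d 0) x)
      \<and> transport T c m x \<in> S (c m)" if "m \<le> n" for m
    using that
  proof (induction m)
    case 0
    then show ?case using assms by simp
  next
    case (Suc m)
    obtain \<sigma> where \<sigma>: "\<sigma> \<in> K" "{c m, d m, c (Suc m), d (Suc m)} \<subseteq> \<sigma>"
      using assms(1)[of m] Suc by auto
    have K: "{c m, c (Suc m), d (Suc m)} \<in> K" "{c m, d m, d (Suc m)} \<in> K" "{c m, c (Suc m)} \<in> K"
      by (rule subsimplex[OF \<sigma>(1)]; use \<sigma>(2) in auto)+
    let ?y = "transport T c m x"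
    have IH: "T (c m) (d m) ?y = transport T d m (T (c 0) (d 0) x)" "?y \<in> S (c m)"
      using Suc by auto
    have "T (c (Suc m)) (d (Suc m)) (T (c m) (c (Suc m)) ?y) = T (d m) (d (Suc m)) (T (c m) (d m) ?y)"
      using T_comp[OF K(1) IH(2)] T_comp[OF K(2) IH(2)] by simp
    then show ?case using IH T_in[OF K(3)] by simp
  qed
  then show ?thesis by simp
qed

text \<open>A null homotopy of the loop is cut into small squares; the transports along consecutive
  rows of squares are conjugate by the ladder lemma, and the last row is constant.\<close>

theorem transport_loop:
  assumes sc: "simply_connected (geometric_realization K)"
    and E: "\<And>i. i < n \<Longrightarrow> {u i, u (Suc i)} \<in> K" and n: "n > 0" and loop: "u n = u 0"
    and x: "x \<in> S (u 0)"
  shows "transport T u n x = x"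
proof -
  define g where "g = edge_path u n"
  have g_in: "g t \<in> geometric_realization K" if "0 \<le> t" "t \<le> 1" for t
    unfolding g_def using that by (intro edge_path_in_realization[OF complex n] E)
  have gl: "path g" "pathfinish g = pathstart g" "path_image g \<subseteq> geometric_realization K"
    using path_edge_path g_in edge_path_vertex[of 0 n u] edge_path_vertex[of n n u] n loop
    by (auto simp: g_def pathstart_def pathfinish_def path_image_def)
  let ?q = "\<lambda>_::real. g 0"
  have "path ?q" "pathfinish ?q = pathstart ?q" "path_image ?q \<subseteq> geometric_realization K"
    using g_in by (auto simp: path_def pathstart_def pathfinish_def path_image_def)
  with gl sc have "homotopic_loops (geometric_realization K) g ?q"
    unfolding simply_connected_def by blast
  then obtain h where h: "continuous_on ({0..1::real} \<times> {0..1}) h"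
      "h \<in> ({0..1} \<times> {0..1}) \<rightarrow> geometric_realization K"
      "\<And>t. t \<in> {0..1} \<Longrightarrow> h (0, t) = g t" "\<And>t. t \<in> {0..1} \<Longrightarrow> h (1, t) = g 0"
      "\<And>s. s \<in> {0..1} \<Longrightarrow> h (s, 1) = h (s, 0)"
    unfolding homotopic_loops by (auto simp: pathstart_def pathfinish_def)
  obtain N c where N: "N > 0" "n dvd N" and
    star: "\<And>i j s t. \<lbrakk>i < N; j < N; real i \<le> real N * s; real N * s \<le> real (Suc i);
       real j \<le> real N * t; real N * t \<le> real (Suc j)\<rbrakk> \<Longrightarrow> h (s, t) (c i j) > 0"
    using square_star_grid[OF h(1,2) n] by metis
  \<comment> \<open>Column \<open>N\<close> is identified with column 0, so each row is a closed
    sequence; this fits because every stage of the homotopy is a loop.\<close>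
  define d where "d i j = c i (if j = N then 0 else j)" for i j
  have simp_h: "{a. h (s, t) a > 0} \<in> K" if "0 \<le> s" "s \<le> 1" "0 \<le> t" "t \<le> 1" for s t
    using that h(2) by (intro realization_support(1)) auto
  have d_left: "h (s, real j / real N) (d i j) > 0"
    if "i < N" "j \<le> N" "real i \<le> real N * s" "real N * s \<le> real (Suc i)" for i j s
  proof (cases "j = N")
    case True
    have "0 \<le> real N * s" using that(3) of_nat_0_le_iff order_trans by blast
    then have s0: "0 \<le> s" using N by (simp add: zero_le_mult_iff)
    have "real (Suc i) \<le> real N" using that(1) by linarith
    then have "real N * s \<le> real N * 1" using that(4) by linarith
    then have "s \<in> {0..1}" using N s0 by simp
    then show ?thesis using star[of i 0 s 0] that N True h(5) by (simp add: d_def)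
  next
    case False
    then show ?thesis using star[of i j s "real j / real N"] that N by (simp add: d_def)
  qed
  have d_right: "h (s, real (Suc j) / real N) (d i j) > 0"
    if "i < N" "j < N" "real i \<le> real N * s" "real N * s \<le> real (Suc i)" for i j s
    using star[of i j s "real (Suc j) / real N"] that N by (simp add: d_def)
  \<comment> \<open>The four cells around a grid point share it, so their star vertices are all
    positive at its image and lie in one simplex.\<close>
  have corner: "\<exists>\<sigma>\<in>K. {d i j, d (Suc i) j, d i (Suc j), d (Suc i) (Suc j)} \<subseteq> \<sigma>"
    if "Suc i < N" "j < N" for i j
  proof -
    let ?s = "real (Suc i) / real N" and ?t = "real (Suc j) / real N"
    have "{d i j, d (Suc i) j, d i (Suc j), d (Suc i) (Suc j)} \<subseteq> {a. h (?s, ?t) a > 0}"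
      using d_left[of i "Suc j" ?s] d_left[of "Suc i" "Suc j" ?s] d_right[of i j ?s] d_right[of "Suc i" j ?s]
        that N by simp
    moreover have "{a. h (?s, ?t) a > 0} \<in> K" using that by (intro simp_h) auto
    ultimately show ?thesis by blast
  qed
  \<comment> \<open>The homotopy is constant on the side \<open>s = 1\<close>, so the last row lies
    in the support of a single point.\<close>
  have last: "transport T (d (N - 1)) N y = y" if "y \<in> S (d (N - 1) 0)" for y
  proof -
    have s: "real (N - 1) \<le> real N * 1" "real N * 1 \<le> real (Suc (N - 1))" using N by auto
    have "g 0 (d (N - 1) j) > 0" if "j \<le> N" for j
    proof -
      have "real j / real N \<in> {0..1}" using that N by simp
      then show ?thesis using d_left[OF _ that s] N h(4) by auto
    qed
    moreover have "{a. g 0 a > 0} \<in> K" using realization_support(1)[OF g_in[of 0]] by simp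
    ultimately have "transport T (d (N - 1)) N y = T (d (N - 1) 0) (d (N - 1) N) y"
      and "{d (N - 1) 0} \<in> K"
      using that transport_in_simplex subsimplex[of "{a. g 0 a > 0}" "{d (N - 1) 0}"] by auto
    moreover from this(2) have "d (N - 1) 0 \<in> vertices K" by (auto simp: vertices_def)
    ultimately show ?thesis using that T_refl[of "d (N - 1) 0" y] by (simp add: d_def)
  qed
  \<comment> \<open>Induction from row \<open>N - 1\<close> down to row 0; the transition along
    column 0 can be cancelled by \<open>T_inverse\<close>.\<close>
  have rows: "transport T (d (N - Suc i)) N y = y" if "y \<in> S (d (N - Suc i) 0)" "i < N" for i y
    using that
  proof (induction i arbitrary: y)
    case 0
    then show ?case using last by simp
  next
    case (Suc i)
    let ?a = "N - Suc (Suc i)" and ?b = "N - Suc i"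
    have ab: "Suc ?a = ?b" "?b < N" using Suc by auto
    obtain \<sigma> where \<sigma>: "\<sigma> \<in> K" "{d ?a 0, d ?b 0} \<subseteq> \<sigma>" using corner[of ?a 0] ab N by auto
    have e: "{d ?a 0, d ?b 0} \<in> K" by (rule subsimplex[OF \<sigma>]) auto
    have row_edge: "{d ?a j, d ?a (Suc j)} \<in> K" if j: "j < N" for j
    proof -
      obtain \<tau> where "\<tau> \<in> K" "{d ?a j, d ?a (Suc j)} \<subseteq> \<tau>" using corner[of ?a j] ab j by auto
      then show ?thesis using subsimplex by blast
    qed
    have dN: "d i N = d i 0" for i by (simp add: d_def)
    let ?y = "transport T (d ?a) N y"
    have "?y \<in> S (d ?a N)" using row_edge Suc by (intro transport_in) auto
    then have y: "?y \<in> S (d ?a 0)" by (simp add: dN)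
    have "T (d ?a N) (d ?b N) ?y = transport T (d ?b) N (T (d ?a 0) (d ?b 0) y)"
    proof (rule transport_ladder)
      show "\<exists>\<sigma>\<in>K. {d ?a j, d ?b j, d ?a (Suc j), d ?b (Suc j)} \<subseteq> \<sigma>" if "j < N" for j
        using corner[of ?a j] ab that by auto
    qed (use Suc N in auto)
    also have "\<dots> = T (d ?a 0) (d ?b 0) y"
      using Suc T_in[OF e] by auto
    finally have "T (d ?b 0) (d ?a 0) (T (d ?a 0) (d ?b 0) ?y) = T (d ?b 0) (d ?a 0) (T (d ?a 0) (d ?b 0) y)"
      by (simp add: dN)
    then show ?case using T_inverse[OF e] y Suc by simp
  qed
  obtain M where M: "N = n * M" using N by auto
  have M0: "M > 0" using M N by (cases M) auto
  \<comment> \<open>At time \<open>i / n\<close> the loop is at \<open>u i\<close>, the only vertex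
    with a positive coordinate there.\<close>
  have first_vertex: "d 0 (i * M) = u i" if "i \<le> n" for i
  proof -
    have "h (0, real (i * M) / real N) (d 0 (i * M)) > 0"
      using d_left[of 0 "i * M" 0] that N M by simp
    moreover have "real (i * M) / real N = real i / real n" using M M0 by simp
    moreover have "real i / real n \<in> {0..1}" using that n by simp
    ultimately have "edge_path u n (real i / real n) (d 0 (i * M)) > 0" using h(3) by (simp add: g_def)
    then show ?thesis using edge_path_vertex[OF that n, of u "d 0 (i * M)"] by (simp split: if_splits)
  qed
  \<comment> \<open>While the loop runs along its \<open>i\<close>-th edge only the two end vertices
    can be positive, so \<open>M\<close> steps of row 0 collapse to one transition of
    \<open>u\<close>.\<close>
  have first_seg: "d 0 (i * M + k) \<in> {u i, u (Suc i)}" if "i < n" "k \<le> M" for i k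
  proof -
    have "i * M + k \<le> Suc i * M" using that by simp
    also have "\<dots> \<le> n * M" using that by (intro mult_le_mono1) simp
    finally have le: "i * M + k \<le> N" using M by simp
    define t where "t = real (i * M + k) / real N"
    have t: "t \<in> {0..1}" using le N by (simp add: t_def del: of_nat_add of_nat_mult)
    have nt: "real n * t = real i + real k / real M" using M M0 n by (simp add: t_def field_simps)
    have kM: "0 \<le> real k / real M" "real k / real M \<le> 1" using that M0 by auto
    have "edge_path u n t (d 0 (i * M + k)) > 0"
      using d_left[of 0 "i * M + k" 0] le N t h(3) by (simp add: g_def t_def)
    then show ?thesis using edge_path_segment[of i n t u "d 0 (i * M + k)"] that kM
      by (auto simp: nt split: if_splits)
  qed
  have "transport T (d 0) (i * M) x = transport T u i x" if "i \<le> n" for i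
    using that
  proof (induction i)
    case 0
    then show ?case by simp
  next
    case (Suc i)
    let ?y = "transport T u i x"
    have y: "?y \<in> S (u i)" using E x Suc by (intro transport_in) auto
    have "transport T (d 0) (Suc i * M) x = transport T (\<lambda>k. d 0 (i * M + k)) M ?y"
      using transport_add[of T "d 0" "i * M" M x] Suc by (simp add: add.commute)
    also have "\<dots> = T (d 0 (i * M + 0)) (d 0 (i * M + M)) ?y"
      by (rule transport_in_simplex[OF E[of i]]) (use first_seg first_vertex y Suc in auto)
    also have "\<dots> = transport T u (Suc i) x"
      using first_vertex[of i] first_vertex[of "Suc i"] Suc by (simp add: add.commute)
    finally show ?case .
  qed
  from this[of n] have "transport T (d 0) N x = transport T u n x" using M by simp
  moreover have "transport T (d 0) N x = x"
    using rows[of x "N - 1"] first_vertex[of 0] x N by simp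
  ultimately show ?thesis by simp
qed

text \<open>Since transport around loops is trivial, a value chosen at one base vertex of each edge
  component extends independently of the path.\<close>

theorem global_section:
  assumes sc: "simply_connected (geometric_realization K)"
    and ne: "\<And>u. u \<in> vertices K \<Longrightarrow> S u \<noteq> {}"
  obtains f where "\<And>u. u \<in> vertices K \<Longrightarrow> f u \<in> S u"
    "\<And>u w. {u, w} \<in> K \<Longrightarrow> f w = T u w (f u)"
proof -
  define E where "E = {(u, w). {u, w} \<in> K}"
  \<comment> \<open>Adjacency in the covering graph, whose points are a vertex together with an
    element of its stalk.\<close>
  define R where "R = {((u, x), (w, y)). {u, w} \<in> K \<and> x \<in> S u \<and> y = T u w x}"
  have symE: "sym E" by (auto simp: E_def sym_def insert_commute)
  have symR: "sym R"
  proof (rule symI)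
    fix p q assume "(p, q) \<in> R"
    then show "(q, p) \<in> R" unfolding R_def
      by (auto simp: T_in T_inverse insert_commute)
  qed
  \<comment> \<open>A path in the cover between two points over \<open>u\<close> projects to an edge
    loop at \<open>u\<close>, whose transport is the identity.\<close>
  have unique: "x = y" if uy: "((u, x), (u, y)) \<in> R\<^sup>*" for u x y
  proof -
    obtain n where "((u, x), (u, y)) \<in> R ^^ n" using rtrancl_imp_relpow[OF uy] by auto
    then obtain p where p: "p 0 = (u, x)" "p n = (u, y)" "\<And>i. i < n \<Longrightarrow> (p i, p (Suc i)) \<in> R"
      unfolding relpow_fun_conv by blast
    show ?thesis
    proof (cases "n = 0")
      case True
      then show ?thesis using p by simp
    next
      case False
      let ?u = "\<lambda>i. fst (p i)"
      have step: "{?u i, ?u (Suc i)} \<in> K" "snd (p (Suc i)) = T (?u i) (?u (Suc i)) (snd (p i))"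
        "snd (p i) \<in> S (?u i)" if "i < n" for i
        using p(3)[OF that] unfolding R_def by auto
      have "transport T ?u i x = snd (p i)" if "i \<le> n" for i
        using that by (induction i) (auto simp: p(1) step(2))
      then have "transport T ?u n x = y" using p(2) by simp
      moreover have "transport T ?u n x = x"
      proof (rule transport_loop[OF sc])
        show "x \<in> S (fst (p 0))" using step(3)[of 0] False p(1) by simp
      qed (use False p step(1) in auto)
      ultimately show ?thesis by simp
    qed
  qed
  \<comment> \<open>The predicate under \<open>SOME\<close> depends only on the edge component, so
    both ends of an edge get the same representative.\<close>
  define rep where "rep u = (SOME v. (v, u) \<in> E\<^sup>*)" for u
  have rep: "(rep u, u) \<in> E\<^sup>*" for u
    unfolding rep_def by (rule someI[of _ u]) simp
  have rep_eq: "rep u = rep w" if "{u, w} \<in> K" for u w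
  proof -
    have "(u, w) \<in> E" "(w, u) \<in> E" using that symE by (auto simp: E_def insert_commute)
    then have "(v, u) \<in> E\<^sup>* \<longleftrightarrow> (v, w) \<in> E\<^sup>*" for v by (meson rtrancl.rtrancl_into_rtrancl)
    then show ?thesis by (simp add: rep_def)
  qed
  have vertex: "u \<in> vertices K" if "{u, w} \<in> K" for u w
    using that by (auto simp: vertices_def)
  have rep_vertex: "rep u \<in> vertices K" if "u \<in> vertices K" for u
    using rep[of u]
  proof (cases rule: converse_rtranclE)
    case base
    then show ?thesis using that by simp
  next
    case (step y)
    then show ?thesis using vertex by (auto simp: E_def)
  qed
  define base where "base v = (SOME x. x \<in> S v)" for v
  have base_in: "base v \<in> S v" if "v \<in> vertices K" for v
    unfolding base_def using ne[OF that] by (simp add: some_in_eq)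
  have reach: "\<exists>x. ((v, base v), (u, x)) \<in> R\<^sup>* \<and> x \<in> S u" if "(v, u) \<in> E\<^sup>*" "v \<in> vertices K" for v u
    using that(1)
  proof (induction rule: rtrancl_induct)
    case base
    then show ?case using base_in[OF that(2)] by blast
  next
    case (step u w)
    then obtain x where x: "((v, base v), (u, x)) \<in> R\<^sup>*" "x \<in> S u" by blast
    have "{u, w} \<in> K" using step by (simp add: E_def)
    then have "((u, x), (w, T u w x)) \<in> R" "T u w x \<in> S w" using x T_in by (auto simp: R_def)
    then show ?case using x(1) by (meson rtrancl.rtrancl_into_rtrancl)
  qed
  define f where "f u = (SOME x. ((rep u, base (rep u)), (u, x)) \<in> R\<^sup>* \<and> x \<in> S u)" for u
  have f: "((rep u, base (rep u)), (u, f u)) \<in> R\<^sup>*" "f u \<in> S u" if "u \<in> vertices K" for u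
    using someI_ex[OF reach[OF rep rep_vertex[OF that]]] by (auto simp: f_def)
  show thesis
  proof
    fix u w assume uw: "{u, w} \<in> K"
    then have vs: "u \<in> vertices K" "w \<in> vertices K" by (auto simp: vertices_def)
    have "((u, f u), (w, T u w (f u))) \<in> R" using f(2)[OF vs(1)] uw by (simp add: R_def)
    with f(1)[OF vs(1)] have 1: "((rep u, base (rep u)), (w, T u w (f u))) \<in> R\<^sup>*" by simp
    have "((w, f w), (rep w, base (rep w))) \<in> R\<^sup>*"
      using f(1)[OF vs(2)] sym_rtrancl[OF symR] by (meson symD)
    with 1 have "((w, f w), (w, T u w (f u))) \<in> R\<^sup>*" using rep_eq[OF uw] by simp
    then show "f w = T u w (f u)" by (rule unique)
  qed (rule f(2))
qed

end

subsection \<open>The cubic recurrence and the flux inequalities\<close>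

text \<open>The root is \<open>2 cos (2 \<pi> / 7)\<close>.\<close>

lemma cubic_root_exists:
  obtains l :: real where "1.24 \<le> l" "l \<le> 1.25" "l^3 + l^2 - 2 * l - 1 = 0"
proof -
  have "\<exists>l::real. 1.24 \<le> l \<and> l \<le> 1.25 \<and> l^3 + l^2 - 2 * l - 1 = 0"
    by (intro IVT') (auto intro!: continuous_intros simp: power3_eq_cube power2_eq_square)
  then show thesis using that by blast
qed

text \<open>The cubic says that \<open>l = z + 1 / z\<close> for a primitive 7th root of unity
  \<open>z\<close>. The characteristic polynomial \<open>X^2 - l * X + 1\<close> has the roots
  \<open>z\<close> and \<open>1 / z\<close>, and a constant solution absorbs the term
  \<open>l * p\<close>.\<close>

lemma recurrence_period_7:
  fixes a :: "nat \<Rightarrow> real"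
  assumes l: "l^3 + l^2 - 2 * l - 1 = 0"
    and rec: "\<And>i. a (i + 2) = l * (p + a (i + 1)) - a i"
  shows "a (i + 7) = a i"
proof -
  define x y where "x = a i" and "y = a (i + 1)"
  have l3: "l^3 = 1 + 2 * l - l^2" using l by simp
  have 2: "a (i + 2) = l * (p + y) - x" using rec[of i] by (simp add: x_def y_def)
  have 3: "a (i + 3) = l * (p + a (i + 2)) - y" using rec[of "i + 1"] by (simp add: y_def numeral_eq_Suc)
  have 4: "a (i + 4) = l * (p + a (i + 3)) - a (i + 2)" using rec[of "i + 2"] by (simp add: numeral_eq_Suc)
  have 5: "a (i + 5) = l * (p + a (i + 4)) - a (i + 3)" using rec[of "i + 3"] by (simp add: numeral_eq_Suc)
  have 6: "a (i + 6) = l * (p + a (i + 5)) - a (i + 4)" using rec[of "i + 4"] by (simp add: numeral_eq_Suc)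
  have 7: "a (i + 7) = l * (p + a (i + 6)) - a (i + 5)" using rec[of "i + 5"] by (simp add: numeral_eq_Suc)
  \<comment> \<open>Reductions modulo the cubic are recorded as explicit multiples of
    \<open>c\<close>, so only polynomial identities remain to be checked.\<close>
  define c where "c = l^3 + l^2 - 2 * l - 1"
  have c: "c = 0" using l by (simp add: c_def)
  note ring = c_def power2_eq_square power3_eq_cube algebra_simps
  have "a (i + 3) = (l + l^2) * p + (l^2 - 1) * y - l * x"
    unfolding 3 2 by (simp add: ring)
  note 3 = this
  have "a (i + 4) = (1 + 2 * l) * p + (1 - l^2) * y + (1 - l^2) * x + c * (p + y)"
    unfolding 4 3 2 by (simp add: ring)
  then have 4: "a (i + 4) = (1 + 2 * l) * p + (1 - l^2) * y + (1 - l^2) * x" by (simp add: c)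
  have "a (i + 5) = (l + l^2) * p - l * y + (l^2 - 1) * x - c * (x + y)"
    unfolding 5 4 3 by (simp add: ring)
  then have 5: "a (i + 5) = (l + l^2) * p - l * y + (l^2 - 1) * x" by (simp add: c)
  have "a (i + 6) = l * p - y + l * x + c * (p + x)"
    unfolding 6 5 4 by (simp add: ring)
  then have 6: "a (i + 6) = l * p - y + l * x" by (simp add: c)
  have "a (i + 7) = x" unfolding 7 6 5 by (simp add: ring)
  then show ?thesis by (simp add: x_def)
qed

text \<open>\<open>Q\<close> is the triangle relation, a quadratic equation for \<open>r\<close>.
  Its discriminant is \<open>(l * (p + q) - 2 * r)^2\<close>, which is at most
  \<open>(p + q)^2\<close> because \<open>l^2 + l - 2 \<le> 1\<close>.\<close>

lemma flux_le:
  fixes p q r l :: real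
  assumes "1.24 \<le> l" "l \<le> 1.25" "p > 0" "q > 0"
    and Q: "(2 + l) * (p^2 + q^2 + r^2) = l * (p + q + r)^2"
  shows "\<bar>l / 2 + 1 - (p + q + r) / (p + q)\<bar> \<le> 1 / 2"
proof -
  have "(l * (p + q) - 2 * r)^2 = 4 * (l * (p * q) - p^2 - q^2) + l^2 * (p + q)^2" using Q by algebra
  also have "\<dots> = (l^2 + l - 2) * (p + q)^2 - (l + 2) * (p - q)^2" by algebra
  also have "\<dots> \<le> (l^2 + l - 2) * (p + q)^2" using assms by simp
  also have "\<dots> \<le> 1 * (p + q)^2"
  proof (rule mult_right_mono)
    have "l * l \<le> 1.25 * 1.25" using assms by (intro mult_mono) auto
    then show "l^2 + l - 2 \<le> 1" using assms by (simp add: power2_eq_square)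
  qed simp
  finally have "\<bar>l * (p + q) - 2 * r\<bar> \<le> \<bar>p + q\<bar>" by (simp add: abs_le_square_iff)
  moreover have "l / 2 + 1 - (p + q + r) / (p + q) = (l * (p + q) - 2 * r) / (2 * (p + q))"
    using assms by (simp add: field_simps)
  ultimately show ?thesis using assms by (simp add: abs_mult field_simps)
qed

text \<open>In elementary symmetric functions \<open>Q\<close> becomes
  \<open>e1^2 = (2 + l) * e2\<close>, and \<open>e3\<close> enters the sum only through the common
  denominator \<open>P = e1 * e2 - e3\<close>. An upper bound on \<open>e3\<close> therefore
  suffices.\<close>

lemma divergence_ge:
  fixes p q r l :: real
  assumes "1.24 \<le> l" "l \<le> 1.25" and pos: "p > 0" "q > 0" "r > 0"
    and Q: "(2 + l) * (p^2 + q^2 + r^2) = l * (p + q + r)^2"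
  shows "(l / 2 + 1 - (p + q + r) / (p + q)) + (l / 2 + 1 - (p + q + r) / (q + r))
       + (l / 2 + 1 - (p + q + r) / (r + p)) \<ge> 1 / 14"
proof -
  define e1 e2 e3 where "e1 = p + q + r" and "e2 = p * q + q * r + r * p" and "e3 = p * q * r"
  have e: "e1 > 0" "e2 > 0" "e3 > 0" using pos by (auto simp: e1_def e2_def e3_def add_pos_pos)
  have e1sq: "e1^2 = (2 + l) * e2" using Q assms(1) unfolding e1_def e2_def by algebra
  \<comment> \<open>This is \<open>x^2 + y^2 + z^2 \<ge> x * y + y * z + z * x\<close> for the
    products \<open>p * q\<close>, \<open>q * r\<close>, \<open>r * p\<close>.\<close>
  have e3: "3 * e1 * e3 \<le> e2^2"
  proof -
    have "e2^2 - 3 * e1 * e3 = ((p * q - q * r)^2 + (q * r - r * p)^2 + (r * p - p * q)^2) / 2"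
      unfolding e1_def e2_def e3_def by (simp add: power2_eq_square algebra_simps)
    then show ?thesis by (smt (verit) zero_le_power2 divide_nonneg_pos)
  qed
  define P where "P = (p + q) * (q + r) * (r + p)"
  have P: "P > 0" using pos by (simp add: P_def)
  have Peq: "P = e1 * e2 - e3" unfolding P_def e1_def e2_def e3_def by algebra
  have "(p + q + r) / (p + q) + (p + q + r) / (q + r) + (p + q + r) / (r + p) = e1 * (e1^2 + e2) / P"
  proof -
    have "e1 / x + e1 / y + e1 / z = e1 * (y * z + x * z + x * y) / (x * y * z)"
      if "x \<noteq> 0" "y \<noteq> 0" "z \<noteq> 0" for x y z :: real
      using that by (simp add: field_simps)
    from this[of "p + q" "q + r" "r + p"] pos
    have "e1 / (p + q) + e1 / (q + r) + e1 / (r + p)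
      = e1 * ((q + r) * (r + p) + (p + q) * (r + p) + (p + q) * (q + r)) / P"
      by (simp add: P_def add_pos_pos)
    also have "(q + r) * (r + p) + (p + q) * (r + p) + (p + q) * (q + r) = e1^2 + e2"
      unfolding e1_def e2_def by algebra
    finally show ?thesis by (simp add: e1_def)
  qed
  moreover have "e1 * (e1^2 + e2) \<le> (3 * l / 2 + 3 - 1 / 14) * P"
  proof -
    \<comment> \<open>The constant is the left side at \<open>l = 1.24\<close>, rounded
      down.\<close>
    have A: "3 * l / 2 + 3 - 1 / 14 \<ge> 4.78" using assms by simp
    \<comment> \<open>The factor \<open>3 * e1\<close> leaves only even powers of \<open>e1\<close>,
      which \<open>e1sq\<close> turns into \<open>e2\<close>, apart from the term
      \<open>3 * e1 * e3\<close> bounded above.\<close>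
    have "3 * e1 * (e1 * (e1^2 + e2)) = 3 * (2 + l) * (3 + l) * e2^2"
      using e1sq by algebra
    also have "\<dots> \<le> 4.78 * (3 * (2 + l) - 1) * e2^2"
    proof (rule mult_right_mono)
      have "l * l \<le> 1.25 * 1.25" using assms by (intro mult_mono) auto
      then show "3 * (2 + l) * (3 + l) \<le> 4.78 * (3 * (2 + l) - 1)" using assms
        by (simp add: algebra_simps)
    qed simp
    also have "\<dots> = 4.78 * (3 * e1^2 * e2 - e2^2)" using e1sq by algebra
    also have "\<dots> \<le> 4.78 * (3 * e1^2 * e2 - 3 * e1 * e3)" using e3 by simp
    also have "\<dots> = 3 * e1 * (4.78 * P)" unfolding Peq by algebra
    finally have "e1 * (e1^2 + e2) \<le> 4.78 * P" using e by simp
    also have "\<dots> \<le> (3 * l / 2 + 3 - 1 / 14) * P" using A P by (intro mult_right_mono) auto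
    finally show ?thesis .
  qed
  then have "e1 * (e1^2 + e2) / P \<le> 3 * l / 2 + 3 - 1 / 14" using P by (simp add: divide_le_eq)
  ultimately show ?thesis by linarith
qed

subsection \<open>Horofunctions on surfaces of degree 7\<close>

text \<open>All natural numbers serve as indices, with period 7, so a recurrence around the link
  needs no wrap-around case.\<close>

definition link_cycle :: "'a set set \<Rightarrow> 'a \<Rightarrow> (nat \<Rightarrow> 'a) \<Rightarrow> bool" where
  "link_cycle K u c \<longleftrightarrow> (\<forall>i j. c i = c j \<longleftrightarrow> i mod 7 = j mod 7) \<and> (\<forall>i. c i \<noteq> u) \<and>
     (\<forall>t. t \<in> triangles K \<and> u \<in> t \<longleftrightarrow> (\<exists>i. t = {u, c i, c (Suc i)}))"

lemma triangle_distinct: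
  assumes "{x, y, z} \<in> triangles K"
  shows "x \<noteq> y" "x \<noteq> z" "y \<noteq> z"
  using assms by (auto simp: triangles_def card_insert_if split: if_splits)

lemma triangle_cases:
  assumes "t \<in> triangles K" "x \<in> t" "y \<in> t" "x \<noteq> y"
  obtains z where "t = {x, y, z}"
proof -
  have t: "card t = 3" using assms by (simp add: triangles_def)
  then have fin: "finite t" by (simp add: card_ge_0_finite)
  have "card (t - {x, y}) = 1"
    using assms t fin by (simp add: card_Diff_subset)
  then obtain z where "t - {x, y} = {z}" by (auto simp: card_1_singleton_iff)
  then show thesis using that[of z] assms by blast
qed

text \<open>The listed triangles are pairwise distinct as \<open>n \<ge> 3\<close>, so the length of
  the link is the number of triangles.\<close>

lemma link_cycle_exists:
  assumes "triangulated_surface K" "u \<in> vertices K" "card {t \<in> triangles K. u \<in> t} = 7"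
  obtains c where "link_cycle K u c"
proof -
  obtain n w where n: "n \<ge> 3" and inj: "inj_on w {..<n}"
    and tr: "{t \<in> triangles K. u \<in> t} = (\<lambda>i. {u, w i, w (Suc i mod n)}) ` {..<n}"
    using assms unfolding triangulated_surface_def by blast
  have tri: "{u, w i, w (Suc i mod n)} \<in> triangles K" if "i < n" for i
    using tr that by blast
  have u: "w i \<noteq> u" if "i < n" for i using triangle_distinct(1)[OF tri[OF that]] by simp
  have wi: "w i = w j \<longleftrightarrow> i = j" if "i < n" "j < n" for i j
    using inj that by (auto simp: inj_on_def)
  have "inj_on (\<lambda>i. {u, w i, w (Suc i mod n)}) {..<n}"
  proof (rule inj_onI)
    fix i j assume ij: "i \<in> {..<n}" "j \<in> {..<n}" "{u, w i, w (Suc i mod n)} = {u, w j, w (Suc j mod n)}"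
    have lt: "i < n" "j < n" "Suc i mod n < n" "Suc j mod n < n" using ij n by auto
    have "(w i = w j \<or> w i = w (Suc j mod n)) \<and> (w j = w i \<or> w j = w (Suc i mod n))"
      using ij(3) u[OF lt(1)] u[OF lt(2)] by (auto simp: set_eq_iff)
    \<comment> \<open>Distinct indices would each be the cyclic successor of the other, which is
      impossible for \<open>n \<ge> 3\<close>.\<close>
    then have "i = j \<or> (i = Suc j mod n \<and> j = Suc i mod n)" using wi lt by metis
    then show "i = j" using lt n by (auto simp: mod_Suc split: if_splits)
  qed
  then have "card {t \<in> triangles K. u \<in> t} = n" by (simp add: tr card_image)
  then have n7: "n = 7" using assms(3) by simp
  have "link_cycle K u (\<lambda>i. w (i mod 7))"
    unfolding link_cycle_def
  proof (intro conjI allI)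
    fix t
    have "t \<in> triangles K \<and> u \<in> t \<longleftrightarrow> (\<exists>i<7. t = {u, w i, w (Suc i mod 7)})"
      using tr n7 by blast
    also have "\<dots> \<longleftrightarrow> (\<exists>i. t = {u, w (i mod 7), w (Suc i mod 7)})"
    proof
      assume "\<exists>i<7. t = {u, w i, w (Suc i mod 7)}"
      then obtain i where "i < 7" "t = {u, w i, w (Suc i mod 7)}" by blast
      then show "\<exists>i. t = {u, w (i mod 7), w (Suc i mod 7)}" by (intro exI[of _ i]) simp
    next
      assume "\<exists>i. t = {u, w (i mod 7), w (Suc i mod 7)}"
      then obtain i where "t = {u, w (i mod 7), w (Suc i mod 7)}" by blast
      then show "\<exists>i<7. t = {u, w i, w (Suc i mod 7)}"
        by (intro exI[of _ "i mod 7"]) (simp add: mod_Suc_eq)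
    qed
    finally show "t \<in> triangles K \<and> u \<in> t \<longleftrightarrow> (\<exists>i. t = {u, w (i mod 7), w (Suc i mod 7)})" .
  qed (use u wi n7 in auto)
  then show thesis by (rule that)
qed

lemma add_mod_7_cancel: "(k + i) mod 7 = (k + j) mod 7 \<longleftrightarrow> i mod 7 = j mod (7::nat)"
proof
  assume "(k + i) mod 7 = (k + j) mod 7"
  then have "(6 * k + (k + i)) mod 7 = (6 * k + (k + j)) mod 7" by (rule mod_add_cong[OF refl])
  moreover have "6 * k + (k + m) = m + 7 * k" for m by simp
  ultimately show "i mod 7 = j mod 7" by simp
qed (rule mod_add_cong[OF refl])

text \<open>Multiplication by 6 is negation modulo 7, hence an involution; it replaces the minus
  sign on \<open>nat\<close>.\<close>

lemma mult_6_mod_7_cancel: "(6 * i) mod 7 = (6 * j) mod 7 \<longleftrightarrow> i mod 7 = j mod (7::nat)"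
proof
  assume "(6 * i) mod 7 = (6 * j) mod 7"
  then have "(6 * (6 * i)) mod 7 = (6 * (6 * j)) mod 7" by (rule mod_mult_cong[OF refl])
  moreover have "6 * (6 * m) = m + 7 * (5 * m)" for m :: nat by simp
  ultimately show "i mod 7 = j mod 7" by (metis mod_mult_self2)
qed (rule mod_mult_cong[OF refl])

lemma link_cycle_eq:
  "\<lbrakk>link_cycle K u c; i mod 7 = j mod 7\<rbrakk> \<Longrightarrow> c i = c j"
  by (simp add: link_cycle_def)

lemma link_cycle_shift:
  assumes c: "link_cycle K u c"
  shows "link_cycle K u (\<lambda>i. c (k + i))"
  unfolding link_cycle_def
proof (intro conjI allI)
  show "c (k + i) = c (k + j) \<longleftrightarrow> i mod 7 = j mod 7" for i j
    using c add_mod_7_cancel by (simp add: link_cycle_def)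
  show "c (k + i) \<noteq> u" for i using c by (simp add: link_cycle_def)
  fix t
  \<comment> \<open>Modulo 7 the index \<open>i + 6 * k\<close> is \<open>i - k\<close>.\<close>
  have "k + (i + 6 * k) = i + 7 * k" for i by simp
  then have "c i = c (k + (i + 6 * k))" for i by (intro link_cycle_eq[OF c]) (metis mod_mult_self2)
  from this[of i for i] this[of "Suc i" for i]
  have "{u, c i, c (Suc i)} = {u, c (k + (i + 6 * k)), c (k + Suc (i + 6 * k))}" for i by simp
  then have "(\<exists>i. t = {u, c i, c (Suc i)}) \<longleftrightarrow> (\<exists>i. t = {u, c (k + i), c (k + Suc i)})"
    by (metis add_Suc_right)
  then show "t \<in> triangles K \<and> u \<in> t \<longleftrightarrow> (\<exists>i. t = {u, c (k + i), c (k + Suc i)})"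
    using c by (simp add: link_cycle_def)
qed

text \<open>Modulo 7 the index \<open>6 * i\<close> is \<open>-i\<close>, so the same cycle is
  traversed backwards.\<close>

lemma link_cycle_reverse:
  assumes c: "link_cycle K u c"
  shows "link_cycle K u (\<lambda>i. c (6 * i))"
  unfolding link_cycle_def
proof (intro conjI allI)
  show "c (6 * i) = c (6 * j) \<longleftrightarrow> i mod 7 = j mod 7" for i j
    using c mult_6_mod_7_cancel by (simp add: link_cycle_def)
  show "c (6 * i) \<noteq> u" for i using c by (simp add: link_cycle_def)
  fix t
  \<comment> \<open>\<open>6 * i + 6\<close> stands for \<open>-(i + 1)\<close>, the position of
    this triangle in the reversed cycle.\<close>
  have "{u, c i, c (Suc i)} = {u, c (6 * (6 * i + 6)), c (6 * Suc (6 * i + 6))}" for i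
  proof -
    have "6 * Suc (6 * i + 6) = i + 7 * (5 * i + 6)" "6 * (6 * i + 6) = Suc i + 7 * (5 * i + 5)" by simp_all
    then have "c i = c (6 * Suc (6 * i + 6))" "c (Suc i) = c (6 * (6 * i + 6))"
      by (intro link_cycle_eq[OF c]; metis mod_mult_self2)+
    then show ?thesis by (simp add: insert_commute)
  qed
  moreover have "{u, c (6 * i), c (6 * Suc i)} = {u, c (6 * i + 6), c (Suc (6 * i + 6))}" for i
  proof -
    have "c (6 * i) = c (Suc (6 * i + 6))" "c (6 * Suc i) = c (6 * i + 6)"
      by (rule link_cycle_eq[OF c]; simp add: add.commute)+
    then show ?thesis by (simp add: insert_commute)
  qed
  ultimately have "(\<exists>i. t = {u, c i, c (Suc i)}) \<longleftrightarrow> (\<exists>i. t = {u, c (6 * i), c (6 * Suc i)})"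
    by metis
  then show "t \<in> triangles K \<and> u \<in> t \<longleftrightarrow> (\<exists>i. t = {u, c (6 * i), c (6 * Suc i)})"
    using c by (simp add: link_cycle_def)
qed

lemma link_cycle_triangle:
  "link_cycle K u c \<Longrightarrow> {u, c i, c (Suc i)} \<in> triangles K"
  unfolding link_cycle_def by blast

lemma link_cycle_triangleE:
  assumes "link_cycle K u c" "t \<in> triangles K" "u \<in> t"
  obtains i where "t = {u, c i, c (Suc i)}"
proof -
  have "\<exists>i. t = {u, c i, c (Suc i)}" using assms unfolding link_cycle_def by blast
  then show thesis using that by blast
qed

text \<open>The middle index is \<open>Suc i\<close> so that both of its neighbours have natural
  indices.\<close>

lemma link_cycle_edge:
  assumes c: "link_cycle K u c"
  shows "t \<in> triangles K \<and> u \<in> t \<and> c (Suc i) \<in> t \<longleftrightarrow>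
    t = {u, c i, c (Suc i)} \<or> t = {u, c (Suc i), c (Suc (Suc i))}"
proof
  assume t: "t \<in> triangles K \<and> u \<in> t \<and> c (Suc i) \<in> t"
  then obtain j where j: "t = {u, c j, c (Suc j)}" using link_cycle_triangleE[OF c] by metis
  then have "c (Suc i) = c j \<or> c (Suc i) = c (Suc j)" using t c by (auto simp: link_cycle_def)
  then have "Suc i mod 7 = j mod 7 \<or> Suc i mod 7 = Suc j mod 7" using c by (simp add: link_cycle_def)
  then have "(Suc i mod 7 = j mod 7 \<and> Suc (Suc i) mod 7 = Suc j mod 7)
      \<or> (Suc i mod 7 = Suc j mod 7 \<and> i mod 7 = j mod 7)"
    using add_mod_7_cancel[of 1 "Suc i" j] add_mod_7_cancel[of 1 i j] by simp
  then have "(c (Suc i) = c j \<and> c (Suc (Suc i)) = c (Suc j)) \<or> (c (Suc i) = c (Suc j) \<and> c i = c j)"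
    using link_cycle_eq[OF c] by blast
  then show "t = {u, c i, c (Suc i)} \<or> t = {u, c (Suc i), c (Suc (Suc i))}" using j by auto
next
  assume "t = {u, c i, c (Suc i)} \<or> t = {u, c (Suc i), c (Suc (Suc i))}"
  then show "t \<in> triangles K \<and> u \<in> t \<and> c (Suc i) \<in> t" using link_cycle_triangle[OF c] by blast
qed

lemma link_cycle_next_neq: "link_cycle K u c \<Longrightarrow> c i \<noteq> c (Suc (Suc i))"
  using add_mod_7_cancel[of i 0 2] by (simp add: link_cycle_def)

text \<open>The bounds single out \<open>2 cos (2 pi / 7)\<close> among the three real roots of the
  cubic.\<close>

locale degree7_surface =
  fixes K :: "'a set set" and l :: real
  assumes surface: "triangulated_surface K"
    and degree7: "\<And>u. u \<in> vertices K \<Longrightarrow> card {t \<in> triangles K. u \<in> t} = 7"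
    and l_lower: "1.24 \<le> l" and l_upper: "l \<le> 1.25" and l_root: "l^3 + l^2 - 2 * l - 1 = 0"
begin

lemma face: "\<lbrakk>s \<in> K; s' \<subseteq> s; s' \<noteq> {}\<rbrakk> \<Longrightarrow> s' \<in> K"
  using surface simplex_face unfolding triangulated_surface_def by metis

lemma in_triangle: "\<sigma> \<in> K \<Longrightarrow> \<exists>t\<in>triangles K. \<sigma> \<subseteq> t"
  using surface unfolding triangulated_surface_def by blast

text \<open>A shift moves the given triangle to the start, and a reversal corrects the order of
  \<open>w\<close> and \<open>z\<close> if necessary.\<close>

lemma link_cycle_from:
  assumes t: "{u, w, z} \<in> triangles K"
  obtains c where "link_cycle K u c" "c 0 = w" "c 1 = z"
proof -
  have "u \<in> vertices K" using t by (auto simp: triangles_def vertices_def)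
  then obtain c where c: "link_cycle K u c" using link_cycle_exists surface degree7 by metis
  obtain k where k: "{u, w, z} = {u, c k, c (Suc k)}"
    using link_cycle_triangleE[OF c t] by blast
  have ne: "w \<noteq> u" "z \<noteq> u" "w \<noteq> z" using triangle_distinct[OF t] by auto
  then consider "w = c k" "z = c (Suc k)" | "w = c (Suc k)" "z = c k"
    using k by (auto simp: set_eq_iff)
  then show thesis
  proof cases
    case 1
    then show thesis using that[OF link_cycle_shift[OF c, of k]] by simp
  next
    case 2
    have "c (Suc k + 6) = c k" by (rule link_cycle_eq[OF c]) simp
    then show thesis using 2 that[OF link_cycle_reverse[OF link_cycle_shift[OF c, of "Suc k"]]] by simp
  qed
qed

lemma link_cycle_at:
  assumes t: "t \<in> triangles K" "u \<in> t"
  obtains c where "link_cycle K u c" "t = {u, c 0, c 1}"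
proof -
  have "u \<in> vertices K" using t by (auto simp: triangles_def vertices_def)
  then obtain c where c: "link_cycle K u c" using link_cycle_exists surface degree7 by metis
  obtain i where i: "t = {u, c i, c (Suc i)}" using link_cycle_triangleE[OF c t] .
  show thesis using that[OF link_cycle_shift[OF c, of i]] i by simp
qed

text \<open>With \<open>w = c 1\<close> in the link of \<open>u\<close>, the third vertices are
  \<open>c 0\<close> and \<open>c 2\<close>.\<close>

lemma edge_in_two_triangles:
  assumes "e \<in> edges K"
  shows "card {t \<in> triangles K. e \<subseteq> t} = 2"
proof -
  obtain u w where e: "e = {u, w}" "u \<noteq> w" using assms by (auto simp: edges_def card_2_iff)
  obtain t where t: "t \<in> triangles K" "e \<subseteq> t" using in_triangle assms by (auto simp: edges_def)
  then obtain z where "t = {u, w, z}" using triangle_cases e by (metis insert_subset)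
  then have "{u, z, w} \<in> triangles K" using t by (simp add: insert_commute)
  then obtain c where c: "link_cycle K u c" "c 1 = w" using link_cycle_from by metis
  have "{t \<in> triangles K. e \<subseteq> t} = {{u, c 0, c (Suc 0)}, {u, c (Suc 0), c (Suc (Suc 0))}}"
    using link_cycle_edge[OF c(1), of _ 0] c(2) e by auto
  moreover have "{u, c 0, c (Suc 0)} \<noteq> {u, c (Suc 0), c (Suc (Suc 0))}"
    using link_cycle_next_neq[OF c(1), of 0] triangle_distinct[OF link_cycle_triangle[OF c(1), of 0]] by auto
  ultimately show ?thesis by simp
qed

text \<open>The second condition is \<open>p\<^sup>2 + q\<^sup>2 + r\<^sup>2 = l (pq + qr + rp)\<close> for the three values on \<open>t\<close>.\<close>

definition lightlike :: "'a set \<Rightarrow> ('a \<Rightarrow> real) \<Rightarrow> bool" where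
  "lightlike t \<phi> \<longleftrightarrow> (\<forall>x\<in>t. \<phi> x > 0) \<and> (2 + l) * (\<Sum>x\<in>t. (\<phi> x)\<^sup>2) = l * (\<Sum>x\<in>t. \<phi> x)\<^sup>2"

lemma lightlike_triple:
  assumes "{x, y, z} \<in> triangles K"
  shows "lightlike {x, y, z} \<phi> \<longleftrightarrow> \<phi> x > 0 \<and> \<phi> y > 0 \<and> \<phi> z > 0 \<and>
    (2 + l) * ((\<phi> x)\<^sup>2 + (\<phi> y)\<^sup>2 + (\<phi> z)\<^sup>2) = l * (\<phi> x + \<phi> y + \<phi> z)\<^sup>2"
  using triangle_distinct[OF assms] by (auto simp: lightlike_def add.assoc)

lemma lightlike_cong: "(\<And>x. x \<in> t \<Longrightarrow> \<phi> x = \<psi> x) \<Longrightarrow> lightlike t \<phi> \<longleftrightarrow> lightlike t \<psi>"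
  by (simp add: lightlike_def)

text \<open>In the hyperboloid model the four vertices of two adjacent triangles satisfy this linear
  relation as vectors; here it is paired with a fixed vector.\<close>

definition edge_relation :: "'a \<Rightarrow> ('a \<Rightarrow> real) \<Rightarrow> bool" where
  "edge_relation u \<phi> \<longleftrightarrow> (\<forall>w z z'. {u, w, z} \<in> triangles K \<and> {u, w, z'} \<in> triangles K \<and> z \<noteq> z'
     \<longrightarrow> \<phi> z + \<phi> z' = l * (\<phi> u + \<phi> w))"

text \<open>Around the link the condition becomes the recurrence of
  \<open>recurrence_period_7\<close> with \<open>p\<close> the value at \<open>u\<close>.\<close>

lemma edge_relation_link:
  assumes c: "link_cycle K u c"
  shows "edge_relation u \<phi> \<longleftrightarrow> (\<forall>i. \<phi> (c i) + \<phi> (c (i + 2)) = l * (\<phi> u + \<phi> (c (i + 1))))"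
proof
  assume r: "edge_relation u \<phi>"
  show "\<forall>i. \<phi> (c i) + \<phi> (c (i + 2)) = l * (\<phi> u + \<phi> (c (i + 1)))"
  proof
    fix i
    have "{u, c (Suc i), c i} \<in> triangles K" "{u, c (Suc i), c (Suc (Suc i))} \<in> triangles K"
      using link_cycle_triangle[OF c] by (auto simp: insert_commute)
    then show "\<phi> (c i) + \<phi> (c (i + 2)) = l * (\<phi> u + \<phi> (c (i + 1)))"
      using r link_cycle_next_neq[OF c, of i] by (simp add: edge_relation_def)
  qed
next
  assume r: "\<forall>i. \<phi> (c i) + \<phi> (c (i + 2)) = l * (\<phi> u + \<phi> (c (i + 1)))"
  show "edge_relation u \<phi>"
    unfolding edge_relation_def
  proof (intro allI impI, elim conjE)
    fix w z z'
    assume t: "{u, w, z} \<in> triangles K" "{u, w, z'} \<in> triangles K" "z \<noteq> z'"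
    obtain i where "{u, w, z} = {u, c i, c (Suc i)}" using link_cycle_triangleE[OF c t(1)] by blast
    then have "w \<in> {u, c i, c (Suc i)}" by (metis insertI1 insertI2)
    then obtain j where "w = c j" using triangle_distinct(1)[OF t(1)] by blast
    \<comment> \<open>Modulo 7, \<open>j + 6\<close> is the predecessor of \<open>j\<close>.\<close>
    moreover have "c j = c (Suc (j + 6))" by (rule link_cycle_eq[OF c]) simp
    ultimately obtain i where w: "w = c (Suc i)" by metis
    have "z = c i \<or> z = c (i + 2)"
      using link_cycle_edge[OF c, of "{u, w, z}" i] t(1) w triangle_distinct[OF t(1)]
      by (auto simp: set_eq_iff)
    moreover have "z' = c i \<or> z' = c (i + 2)"
      using link_cycle_edge[OF c, of "{u, w, z'}" i] t(2) w triangle_distinct[OF t(2)]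
      by (auto simp: set_eq_iff)
    ultimately show "\<phi> z + \<phi> z' = l * (\<phi> u + \<phi> w)"
      using r[rule_format, of i] t(3) w by auto
  qed
qed

text \<open>Solutions vanish off the star of \<open>u\<close>, so that they are determined by their values on the star.\<close>

definition star_solutions :: "'a \<Rightarrow> ('a \<Rightarrow> real) set" where
  "star_solutions u = {\<phi>. (\<forall>x. \<phi> x \<noteq> 0 \<longrightarrow> (\<exists>t\<in>triangles K. u \<in> t \<and> x \<in> t)) \<and>
     edge_relation u \<phi> \<and> (\<forall>t\<in>triangles K. u \<in> t \<longrightarrow> lightlike t \<phi>)}"

text \<open>The recurrence around the link has order two, so the values at \<open>u\<close>,
  \<open>c 0\<close> and \<open>c 1\<close>, the vertices of \<open>t\<close>, determine the
  others.\<close>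

lemma star_solution_unique:
  assumes \<phi>: "\<phi> \<in> star_solutions u" and \<psi>: "\<psi> \<in> star_solutions u"
    and t: "t \<in> triangles K" "u \<in> t" and eq: "\<And>x. x \<in> t \<Longrightarrow> \<phi> x = \<psi> x"
  shows "\<phi> = \<psi>"
proof
  fix x
  obtain c where c: "link_cycle K u c" and tc: "t = {u, c 0, c 1}"
    using link_cycle_at[OF t] .
  have r: "\<phi> (c i) + \<phi> (c (i + 2)) = l * (\<phi> u + \<phi> (c (i + 1)))"
    "\<psi> (c i) + \<psi> (c (i + 2)) = l * (\<psi> u + \<psi> (c (i + 1)))" for i
    using \<phi> \<psi> edge_relation_link[OF c] by (auto simp: star_solutions_def)
  have u: "\<phi> u = \<psi> u" using eq tc by simp
  have ci: "\<phi> (c i) = \<psi> (c i) \<and> \<phi> (c (Suc i)) = \<psi> (c (Suc i))" for i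
  proof (induction i)
    case 0
    then show ?case using eq tc by simp
  next
    case (Suc i)
    then show ?case using r[of i] u by simp
  qed
  show "\<phi> x = \<psi> x"
  proof (cases "\<exists>t\<in>triangles K. u \<in> t \<and> x \<in> t")
    case True
    then obtain i where "x \<in> {u, c i, c (Suc i)}" using link_cycle_triangleE[OF c] by metis
    then show ?thesis using u ci by auto
  next
    case False
    then have "\<phi> x = 0" "\<psi> x = 0" using \<phi> \<psi> by (auto simp: star_solutions_def)
    then show ?thesis by simp
  qed
qed

end

fun link_values :: "real \<Rightarrow> real \<Rightarrow> real \<Rightarrow> real \<Rightarrow> nat \<Rightarrow> real" where
  "link_values l p q r 0 = q"
| "link_values l p q r (Suc 0) = r"
| "link_values l p q r (Suc (Suc i)) = l * (p + link_values l p q r (Suc i)) - link_values l p q r i"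

text \<open>As an equation for \<open>q\<close>, the relation \<open>Q\<close> has \<open>s\<close>
  as its second root by Vieta. The product of the roots is
  \<open>(p - r)^2 + (2 - l) * (p * r)\<close>, which is positive.\<close>

lemma lightlike_reflect:
  fixes p q r l :: real
  assumes l: "l < 2" and pos: "p > 0" "q > 0" "r > 0"
    and Q: "(2 + l) * (p\<^sup>2 + q\<^sup>2 + r\<^sup>2) = l * (p + q + r)\<^sup>2"
  defines "s \<equiv> l * (p + r) - q"
  shows "s > 0" "(2 + l) * (p\<^sup>2 + r\<^sup>2 + s\<^sup>2) = l * (p + r + s)\<^sup>2"
proof -
  have "q * s = (p - r)\<^sup>2 + (2 - l) * (p * r)" using Q unfolding s_def by algebra
  also have "\<dots> > 0" using l pos by (simp add: add_nonneg_pos)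
  finally show "s > 0" using pos by (simp add: zero_less_mult_iff)
  show "(2 + l) * (p\<^sup>2 + r\<^sup>2 + s\<^sup>2) = l * (p + r + s)\<^sup>2" using Q unfolding s_def by algebra
qed

context degree7_surface
begin

text \<open>The recurrence started from \<open>t\<close> closes up after 7 steps, and each step is a
  reflection that preserves the conditions on a triangle.\<close>

lemma star_solution_exists:
  assumes t: "t \<in> triangles K" "u \<in> t" and \<xi>: "lightlike t \<xi>"
  obtains \<phi> where "\<phi> \<in> star_solutions u" "\<And>x. x \<in> t \<Longrightarrow> \<phi> x = \<xi> x"
proof -
  obtain c where c: "link_cycle K u c" and tc: "t = {u, c 0, c 1}"
    using link_cycle_at[OF t] .
  define a where "a = link_values l (\<xi> u) (\<xi> (c 0)) (\<xi> (c 1))"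
  have a: "a 0 = \<xi> (c 0)" "a (Suc 0) = \<xi> (c 1)"
    "\<And>i. a (Suc (Suc i)) = l * (\<xi> u + a (Suc i)) - a i"
    by (auto simp: a_def)
  have "a (i + 7) = a i" for i
    by (rule recurrence_period_7[OF l_root, where p = "\<xi> u"]) (simp add: a(3))
  then have "a (i + 7 * k) = a i" for i k
    by (induction k) (auto simp: add.assoc[symmetric] add.commute[of 7])
  then have a_mod: "a i = a (i mod 7)" for i by (metis mod_mult_div_eq mult.commute)
  have light: "a i > 0 \<and> a (Suc i) > 0 \<and>
     (2 + l) * ((\<xi> u)\<^sup>2 + (a i)\<^sup>2 + (a (Suc i))\<^sup>2) = l * (\<xi> u + a i + a (Suc i))\<^sup>2" for i
  proof (induction i)
    case 0
    then show ?case using \<xi> lightlike_triple[of u "c 0" "c 1" \<xi>] t(1) by (simp add: tc a)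
  next
    case (Suc i)
    have "\<xi> u > 0" using \<xi> t(2) by (simp add: lightlike_def)
    then show ?case using lightlike_reflect[of l "\<xi> u" "a i" "a (Suc i)"] Suc l_upper by (simp add: a(3))
  qed
  define \<phi> where "\<phi> x = (if x = u then \<xi> u else if x \<in> range c then a (SOME i. c i = x) else 0)" for x
  have \<phi>u: "\<phi> u = \<xi> u" by (simp add: \<phi>_def)
  have \<phi>c: "\<phi> (c i) = a i" for i
  proof -
    \<comment> \<open>The chosen index is only congruent to \<open>i\<close> modulo 7, which
      suffices since \<open>a\<close> has period 7.\<close>
    have "c (SOME j. c j = c i) = c i" by (rule someI[of _ i]) simp
    then have "(SOME j. c j = c i) mod 7 = i mod 7" using c by (simp add: link_cycle_def)
    then have "a (SOME j. c j = c i) = a i" using a_mod by metis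
    moreover have "c i \<noteq> u" using c by (simp add: link_cycle_def)
    ultimately show ?thesis by (simp add: \<phi>_def)
  qed
  have "\<phi> \<in> star_solutions u"
    unfolding star_solutions_def
  proof (intro CollectI conjI allI impI ballI)
    fix x assume "\<phi> x \<noteq> 0"
    then have "x = u \<or> x \<in> range c" by (auto simp: \<phi>_def split: if_splits)
    then obtain i where "x \<in> {u, c i, c (Suc i)}" by auto
    then show "\<exists>t\<in>triangles K. u \<in> t \<and> x \<in> t" using link_cycle_triangle[OF c, of i] by blast
  next
    show "edge_relation u \<phi>" unfolding edge_relation_link[OF c] by (simp add: \<phi>u \<phi>c a(3))
  next
    fix t assume "t \<in> triangles K" "u \<in> t"
    then obtain i where i: "t = {u, c i, c (Suc i)}" using link_cycle_triangleE[OF c] by metis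
    show "lightlike t \<phi>" unfolding i lightlike_triple[OF link_cycle_triangle[OF c]] \<phi>u \<phi>c
      using light[of i] \<xi> assms(2) by (auto simp: lightlike_def)
  qed
  moreover have "\<phi> x = \<xi> x" if "x \<in> t" for x
    using that \<phi>u \<phi>c[of 0] \<phi>c[of 1] by (auto simp: tc a)
  ultimately show thesis by (rule that)
qed

lemma star_solutions_nonempty:
  assumes "u \<in> vertices K"
  shows "star_solutions u \<noteq> {}"
proof -
  obtain c where c: "link_cycle K u c" using link_cycle_exists surface degree7 assms by metis
  \<comment> \<open>The larger root of the triangle relation when the other two values are
    1.\<close>
  define r where "r = l + sqrt (l\<^sup>2 + l - 2)"
  define \<xi> where "\<xi> x = (if x = c (Suc 0) then r else 1)" for x
  have t: "{u, c 0, c (Suc 0)} \<in> triangles K" by (rule link_cycle_triangle[OF c])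
  have "1 * 1 \<le> l * l" using l_lower by (intro mult_mono) auto
  then have d: "l\<^sup>2 + l - 2 \<ge> 0" using l_lower by (simp add: power2_eq_square)
  have r: "r > 0" using l_lower d by (simp add: r_def add_pos_nonneg)
  have "(r - l)\<^sup>2 = l\<^sup>2 + l - 2" using d by (simp add: r_def)
  moreover have "(2 + l) * (1\<^sup>2 + 1\<^sup>2 + r\<^sup>2) - l * (1 + 1 + r)\<^sup>2 = 2 * ((r - l)\<^sup>2 - (l\<^sup>2 + l - 2))"
    by (simp add: power2_eq_square algebra_simps)
  ultimately have "(2 + l) * (1\<^sup>2 + 1\<^sup>2 + r\<^sup>2) = l * (1 + 1 + r)\<^sup>2" by simp
  then have "lightlike {u, c 0, c (Suc 0)} \<xi>"
    unfolding lightlike_triple[OF t] using triangle_distinct[OF t] r by (simp add: \<xi>_def)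
  then show ?thesis using star_solution_exists[OF t, of u \<xi>] by blast
qed

section \<open>Continuation of solutions between neighbouring stars\<close>

text \<open>Agreement is demanded on every triangle containing both vertices, so the map does not
  depend on choosing one of them.\<close>

definition continue_to :: "'a \<Rightarrow> 'a \<Rightarrow> ('a \<Rightarrow> real) \<Rightarrow> 'a \<Rightarrow> real" where
  "continue_to u w \<phi> = (THE \<psi>. \<psi> \<in> star_solutions w \<and>
     (\<forall>t\<in>triangles K. u \<in> t \<and> w \<in> t \<longrightarrow> (\<forall>x\<in>t. \<psi> x = \<phi> x)))"

text \<open>One triangle at the edge fixes the solution at \<open>w\<close>. On the other triangle
  agreement follows because the relation across the edge is the same at both ends.\<close>

lemma continue_to:
  assumes uw: "{u, w} \<in> K" and \<phi>: "\<phi> \<in> star_solutions u"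
  shows "continue_to u w \<phi> \<in> star_solutions w"
    and "\<And>t x. \<lbrakk>t \<in> triangles K; u \<in> t; w \<in> t; x \<in> t\<rbrakk> \<Longrightarrow> continue_to u w \<phi> x = \<phi> x"
proof -
  obtain t0 where t0: "t0 \<in> triangles K" "u \<in> t0" "w \<in> t0" using in_triangle[OF uw] by blast
  have l0: "lightlike t0 \<phi>" using \<phi> t0 by (simp add: star_solutions_def)
  obtain \<psi> where \<psi>: "\<psi> \<in> star_solutions w" "\<And>x. x \<in> t0 \<Longrightarrow> \<psi> x = \<phi> x"
    using star_solution_exists[OF t0(1,3) l0] by blast
  have agree: "\<psi> x = \<phi> x" if t: "t \<in> triangles K" "u \<in> t" "w \<in> t" and x: "x \<in> t" for t x
  proof (cases "u = w")
    case True
    then have "\<psi> = \<phi>" using star_solution_unique[OF \<psi>(1) _ t0(1,3) \<psi>(2)] \<phi> by simp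
    then show ?thesis by simp
  next
    case False
    obtain z where z: "t0 = {u, w, z}" using triangle_cases[OF t0 False] .
    obtain z' where z': "t = {u, w, z'}" using triangle_cases[OF t False] .
    show ?thesis
    proof (cases "z = z'")
      case True
      then show ?thesis using \<psi>(2) x z z' by simp
    next
      case ne: False
      have "edge_relation u \<phi>" "edge_relation w \<psi>" using \<phi> \<psi> by (auto simp: star_solutions_def)
      then have "\<phi> z + \<phi> z' = l * (\<phi> u + \<phi> w)" "\<psi> z + \<psi> z' = l * (\<psi> w + \<psi> u)"
        using t0(1) t(1) z z' ne unfolding edge_relation_def by (metis insert_commute)+
      moreover have "\<psi> u = \<phi> u" "\<psi> w = \<phi> w" "\<psi> z = \<phi> z" using \<psi>(2) z by auto
      ultimately show ?thesis using x z' by (auto simp: add.commute)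
    qed
  qed
  have "continue_to u w \<phi> = \<psi>"
    unfolding continue_to_def
  proof (rule the_equality)
    fix \<psi>'
    assume "\<psi>' \<in> star_solutions w \<and> (\<forall>t\<in>triangles K. u \<in> t \<and> w \<in> t \<longrightarrow> (\<forall>x\<in>t. \<psi>' x = \<phi> x))"
    then show "\<psi>' = \<psi>" using star_solution_unique[OF _ \<psi>(1) t0(1,3)] \<psi>(2) t0 by auto
  qed (use \<psi> agree in blast)
  then show "continue_to u w \<phi> \<in> star_solutions w"
    and "\<And>t x. \<lbrakk>t \<in> triangles K; u \<in> t; w \<in> t; x \<in> t\<rbrakk> \<Longrightarrow> continue_to u w \<phi> x = \<phi> x"
    using \<psi>(1) agree by auto
qed

text \<open>For the cocycle condition, both continuations agree with the original solution on a
  triangle containing all three vertices, so uniqueness applies.\<close>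

lemma local_system_star_solutions: "local_system K star_solutions continue_to"
proof
  show complex: "abstract_simplicial_complex K"
    using surface by (simp add: triangulated_surface_def)
  show "continue_to u w \<phi> \<in> star_solutions w" if "{u, w} \<in> K" "\<phi> \<in> star_solutions u" for u w \<phi>
    using continue_to(1) that by blast
  show "continue_to w z (continue_to u w \<phi>) = continue_to u z \<phi>"
    if uwz: "{u, w, z} \<in> K" and \<phi>: "\<phi> \<in> star_solutions u" for u w z \<phi>
  proof -
    have e: "{u, w} \<in> K" "{w, z} \<in> K" "{u, z} \<in> K"
      by (rule face[OF uwz]; simp)+
    obtain t where t: "t \<in> triangles K" "u \<in> t" "w \<in> t" "z \<in> t" using in_triangle[OF uwz] by blast
    let ?\<psi> = "continue_to u w \<phi>"
    have \<psi>: "?\<psi> \<in> star_solutions w" using continue_to(1) e \<phi> by blast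
    show ?thesis
    proof (rule star_solution_unique[OF _ _ t(1,4)])
      fix x assume "x \<in> t"
      then show "continue_to w z ?\<psi> x = continue_to u z \<phi> x"
        using continue_to(2)[OF e(2) \<psi>] continue_to(2)[OF e(1) \<phi>] continue_to(2)[OF e(3) \<phi>] t by simp
    qed (use continue_to(1) e \<phi> \<psi> in auto)
  qed
  show "continue_to u u \<phi> = \<phi>" if "u \<in> vertices K" "\<phi> \<in> star_solutions u" for u \<phi>
  proof -
    have u: "{u, u} \<in> K"
      using that(1) face[of _ "{u, u}"] unfolding vertices_def by auto
    then obtain t where "t \<in> triangles K" "u \<in> t" using in_triangle by blast
    then show ?thesis
      using star_solution_unique[OF continue_to(1)[OF u that(2)] that(2)] continue_to(2)[OF u that(2)] by blast
  qed
qed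

text \<open>A global section assigns a solution to each star. Its values at the centres form
  \<open>F\<close>, which agrees with each local solution on that star.\<close>

theorem global_solution:
  assumes "simply_connected (geometric_realization K)"
  obtains F where "\<And>t. t \<in> triangles K \<Longrightarrow> lightlike t F" "\<And>u. u \<in> vertices K \<Longrightarrow> edge_relation u F"
proof -
  interpret local_system K star_solutions continue_to by (rule local_system_star_solutions)
  obtain f where f: "\<And>u. u \<in> vertices K \<Longrightarrow> f u \<in> star_solutions u"
    "\<And>u w. {u, w} \<in> K \<Longrightarrow> f w = continue_to u w (f u)"
    using global_section[OF assms star_solutions_nonempty] by metis
  define F where "F u = f u u" for u
  have F: "F x = f u x" if "t \<in> triangles K" "u \<in> t" "x \<in> t" for t u x
  proof -
    have ux: "{u, x} \<in> K" by (rule subsimplex[of t]) (use that in \<open>auto simp: triangles_def\<close>)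
    then have "u \<in> vertices K" by (auto simp: vertices_def)
    then show ?thesis using f(2)[OF ux] continue_to(2)[OF ux f(1)] that by (simp add: F_def)
  qed
  show thesis
  proof
    fix t assume t: "t \<in> triangles K"
    then have "card t = 3" "t \<in> K" by (auto simp: triangles_def)
    then obtain u where u: "u \<in> t" by fastforce
    then have "u \<in> vertices K" using \<open>t \<in> K\<close> by (auto simp: vertices_def)
    then have "lightlike t (f u)" using f(1) t u by (auto simp: star_solutions_def)
    then show "lightlike t F" using lightlike_cong[of t F "f u"] F t u by blast
  next
    fix u assume "u \<in> vertices K"
    then have r: "edge_relation u (f u)" using f(1) by (simp add: star_solutions_def)
    show "edge_relation u F"
      unfolding edge_relation_def
    proof (intro allI impI, elim conjE)
      fix w z z'
      assume t: "{u, w, z} \<in> triangles K" "{u, w, z'} \<in> triangles K" "z \<noteq> z'"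
      then have "f u z + f u z' = l * (f u u + f u w)" using r unfolding edge_relation_def by blast
      then show "F z + F z' = l * (F u + F w)"
        using F[OF t(1), of u] F[OF t(2), of u] by simp
    qed
  qed
qed

text \<open>A discrete divergence theorem: the flux is summed over incident pairs of an edge and a
  triangle of \<open>D\<close> in both orders.\<close>

theorem isoperimetric:
  assumes sc: "simply_connected (geometric_realization K)"
    and D: "D \<subseteq> triangles K" "finite D"
  shows "card D \<le> 7 * card {e \<in> edges K. card {t \<in> D. e \<subseteq> t} = 1}"
proof -
  obtain F where light: "\<And>t. t \<in> triangles K \<Longrightarrow> lightlike t F"
    and rel: "\<And>u. u \<in> vertices K \<Longrightarrow> edge_relation u F"
    using global_solution[OF sc] by blast
  \<comment> \<open>With third vertex \<open>z\<close> the last quotient is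
    \<open>1 + F z / sum F e\<close>; using sums over sets avoids naming \<open>z\<close>.\<close>
  define flux where "flux e t = l / 2 + 1 - sum F t / sum F e" for e t
  define E where "E = {e \<in> edges K. \<exists>t\<in>D. e \<subseteq> t}"
  define B where "B = {e \<in> edges K. card {t \<in> D. e \<subseteq> t} = 1}"
  have finE: "finite E"
  proof (rule finite_subset)
    show "E \<subseteq> \<Union> (Pow ` D)" by (auto simp: E_def)
    have "finite t" if "t \<in> D" for t using D(1) that by (auto simp: triangles_def card_ge_0_finite)
    then show "finite (\<Union> (Pow ` D))" using D(2) by blast
  qed
  have BE: "B \<subseteq> E"
  proof
    fix e assume e: "e \<in> B"
    then obtain t where "{t \<in> D. e \<subseteq> t} = {t}" by (auto simp: B_def card_1_singleton_iff)
    then show "e \<in> E" using e by (auto simp: B_def E_def)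
  qed
  have div: "1 / 14 \<le> (\<Sum>e | e \<in> E \<and> e \<subseteq> t. flux e t)" if t: "t \<in> D" for t
  proof -
    have tK: "t \<in> triangles K" using t D by blast
    then obtain p q r where pqr: "t = {p, q, r}" by (auto simp: triangles_def card_3_iff)
    have ne: "p \<noteq> q" "p \<noteq> r" "q \<noteq> r" using triangle_distinct[of p q r K] tK pqr by auto
    have "{e \<in> E. e \<subseteq> t} = {e. e \<subseteq> t \<and> card e = 2}"
    proof -
      have "e \<in> K" if "e \<subseteq> t" "card e = 2" for e
      proof -
        have "e \<noteq> {}" using that by auto
        then show ?thesis using face[of t e] tK that by (simp add: triangles_def)
      qed
      then show ?thesis using t by (auto simp: E_def edges_def)
    qed
    also have "\<dots> = {{p, q}, {q, r}, {r, p}}"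
      using ne unfolding pqr by (auto simp: card_2_iff doubleton_eq_iff)
    finally have eq: "{e \<in> E. e \<subseteq> t} = {{p, q}, {q, r}, {r, p}}" .
    have "(\<Sum>e | e \<in> E \<and> e \<subseteq> t. flux e t) = flux {p, q} t + flux {q, r} t + flux {r, p} t"
      unfolding eq using ne by (subst sum.insert; auto simp: doubleton_eq_iff)+
    also have "\<dots> = (l / 2 + 1 - (F p + F q + F r) / (F p + F q)) + (l / 2 + 1 - (F p + F q + F r) / (F q + F r))
       + (l / 2 + 1 - (F p + F q + F r) / (F r + F p))"
      unfolding flux_def pqr using ne by (simp add: add.assoc)
    also have "\<dots> \<ge> 1 / 14"
      using light[OF tK] tK lightlike_triple[of p q r F] l_lower l_upper
      by (intro divergence_ge) (auto simp: pqr)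
    finally show ?thesis .
  qed
  have flow: "(\<Sum>t | t \<in> D \<and> e \<subseteq> t. flux e t) \<le> (if e \<in> B then 1 / 2 else 0)" if e: "e \<in> E" for e
  proof -
    have eK: "e \<in> edges K" using e by (simp add: E_def)
    then obtain u w where uw: "e = {u, w}" "u \<noteq> w" by (auto simp: edges_def card_2_iff)
    have u: "u \<in> vertices K" using eK uw by (auto simp: edges_def vertices_def)
    have two: "card {t \<in> triangles K. e \<subseteq> t} = 2" by (rule edge_in_two_triangles[OF eK])
    then have fin: "finite {t \<in> triangles K. e \<subseteq> t}" by (simp add: card_ge_0_finite)
    have sub: "{t \<in> D. e \<subseteq> t} \<subseteq> {t \<in> triangles K. e \<subseteq> t}" using D by blast
    have tri: "\<exists>z. t = {u, w, z}" if "t \<in> triangles K" "e \<subseteq> t" for t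
      using triangle_cases[of t K u w] that uw by blast
    show ?thesis
    proof (cases "e \<in> B")
      case True
      then obtain t where t: "{t \<in> D. e \<subseteq> t} = {t}" by (auto simp: B_def card_1_singleton_iff)
      then have tK: "t \<in> triangles K" "e \<subseteq> t" using D by auto
      then obtain z where z: "t = {u, w, z}" using tri by blast
      have ne: "u \<noteq> z" "w \<noteq> z" using triangle_distinct[of u w z K] tK z by auto
      have "\<bar>l / 2 + 1 - (F u + F w + F z) / (F u + F w)\<bar> \<le> 1 / 2"
        using light[OF tK(1)] tK(1) lightlike_triple[of u w z F] l_lower l_upper
        by (intro flux_le) (auto simp: z)
      moreover have "flux e t = l / 2 + 1 - (F u + F w + F z) / (F u + F w)"
        using ne uw by (simp add: flux_def z add.assoc)
      ultimately have "flux e t \<le> 1 / 2" by linarith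
      then show ?thesis using True t by simp
    next
      case False
      have "card {t \<in> D. e \<subseteq> t} \<noteq> 1" using False eK by (simp add: B_def)
      moreover have "{t \<in> D. e \<subseteq> t} \<noteq> {}" using e by (auto simp: E_def)
      then have "card {t \<in> D. e \<subseteq> t} > 0" using D by (simp add: card_gt_0_iff)
      \<comment> \<open>Some but not exactly one of the two triangles at \<open>e\<close> lies in
        \<open>D\<close>, so both do.\<close>
      ultimately have "{t \<in> D. e \<subseteq> t} = {t \<in> triangles K. e \<subseteq> t}"
        using card_mono[OF fin sub] two by (intro card_subset_eq[OF fin sub]) linarith
      then have eq: "{t \<in> D. e \<subseteq> t} = {t \<in> triangles K. e \<subseteq> t}" .
      obtain t t' where tt': "{t \<in> triangles K. e \<subseteq> t} = {t, t'}" "t \<noteq> t'"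
        using two by (meson card_2_iff)
      then have tt: "{t \<in> D. e \<subseteq> t} = {t, t'}" "t \<noteq> t'" using eq by simp_all
      have "t \<in> triangles K" "t' \<in> triangles K" "e \<subseteq> t" "e \<subseteq> t'" using tt'(1) by blast+
      then obtain z z' where z: "t = {u, w, z}" "t' = {u, w, z'}" and K: "{u, w, z} \<in> triangles K" "{u, w, z'} \<in> triangles K"
        using tri by metis
      have ne: "u \<noteq> z" "w \<noteq> z" "u \<noteq> z'" "w \<noteq> z'" using triangle_distinct[OF K(1)] triangle_distinct[OF K(2)] by auto
      have pos: "F u + F w > 0"
        using light[OF K(1)] by (simp add: lightlike_def add_pos_pos)
      have "z \<noteq> z'" using tt z by auto
      with rel[OF u] K have "F z + F z' = l * (F u + F w)" unfolding edge_relation_def by metis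
      \<comment> \<open>The edge is counted in both triangles, which raises the factor
        \<open>l\<close> to \<open>l + 2\<close>; this cancels the two terms
        \<open>l / 2 + 1\<close>.\<close>
      then have "sum F t + sum F t' = (l + 2) * sum F e"
        using ne uw by (simp add: z algebra_simps)
      then have "(sum F t + sum F t') / sum F e = l + 2" using pos uw by simp
      then have "flux e t + flux e t' = 0" by (simp add: flux_def add_divide_distrib)
      then show ?thesis using False tt by simp
    qed
  qed
  have "real (card D) * (1 / 14) = (\<Sum>t\<in>D. 1 / 14)" by simp
  also have "\<dots> \<le> (\<Sum>t\<in>D. \<Sum>e | e \<in> E \<and> e \<subseteq> t. flux e t)" by (rule sum_mono) (rule div)
  also have "\<dots> = (\<Sum>e\<in>E. \<Sum>t | t \<in> D \<and> e \<subseteq> t. flux e t)"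
    by (rule sum.swap_restrict[OF D(2) finE])
  also have "\<dots> \<le> (\<Sum>e\<in>E. if e \<in> B then 1 / 2 else 0)" by (rule sum_mono) (rule flow)
  also have "\<dots> = real (card B) * (1 / 2)"
    using finE BE by (simp add: sum.If_cases Int_absorb1)
  finally show ?thesis unfolding B_def[symmetric] by linarith
qed

end

theorem theorem3:
  fixes K :: "'a set set" and v :: 'a and r :: nat
  assumes "is_X7 K" and "v \<in> vertices K"
  shows "real (comb_perimeter K v r) \<ge> 1 / 7 * real (comb_area K v r)"
proof (cases "finite (triangles (comb_disk K v r))")
  case True
  obtain l :: real where l: "1.24 \<le> l" "l \<le> 1.25" "l^3 + l^2 - 2 * l - 1 = 0" by (rule cubic_root_exists)
  interpret degree7_surface K l
    using assms(1) l unfolding is_X7_def by unfold_locales blast+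
  have "triangles (comb_disk K v r) \<subseteq> triangles K"
    by (induction r) (auto simp: triangles_def)
  then have "comb_area K v r \<le> 7 * comb_perimeter K v r"
    unfolding comb_area_def comb_perimeter_def
    using isoperimetric True assms(1) by (auto simp: is_X7_def)
  then show ?thesis by linarith
qed (simp add: comb_area_def) \<comment> \<open>\<open>card\<close> is 0 on infinite sets, so finiteness of the disk is not an issue.\<close>

end
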